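(* Let $G$ be a group acting acylindrically (by isometries) on a hyperbolic length space $X$. There exists a constant $C>0$ such that for every finite $U\subset G$ with $\lambda(U)>C$, and for all integers $r\geq0$, we have $$|U^r|\geq\left(\frac1{C\lambda(U)}|U|\right)^{[(r+1)/2]}.$$
   Context: The distance in $X$ is denoted $|x-y|$; hyperbolic means hyperbolic in the sense of Gromov. $U^r$ denotes the set of all elements of $G$ that are products of exactly $r$ elements of $U$, and $[x]$ is the integer part of $x$. The $\ell^\infty$-energy of a subset $U\subset G$ is $\lambda(U)=\inf_{x\in X}\sup_{u\in U}|ux-x|$. The action of $G$ on $X$ is acylindrical if there exist two functions $N,\kappa:\mathbb R_+\to\mathbb R_+$ such that for every $r\geq0$ and all points $x,y\in X$ with $|x-y|\geq\kappa(r)$, there are at most $N(r)$ elements $g\in G$ such that $|x-gx|\leq r$ and $|y-gy|\leq r$. *)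

theory Defs
  imports "HOL-Analysis.Analysis" "HOL-Algebra.Group_Action"
begin

text \<open>The length of a path is the supremum of the lengths of its inscribed polygons; it is
  infinite for non-rectifiable paths.\<close>

definition path_length :: "(real \<Rightarrow> 'a::metric_space) \<Rightarrow> ennreal" where
  "path_length p =
     (SUP ts \<in> {ts. sorted ts \<and> set ts \<subseteq> {0..1}}.
        \<Sum>i < length ts - 1. ennreal (dist (p (ts ! i)) (p (ts ! Suc i))))"

definition length_space :: "'a::metric_space itself \<Rightarrow> bool" where
  "length_space _ \<longleftrightarrow>
     (\<forall>x y :: 'a. ennreal (dist x y) =
        (INF p \<in> {p. path p \<and> pathstart p = x \<and> pathfinish p = y}. path_length p))"

definition gromov_product :: "'a::metric_space \<Rightarrow> 'a \<Rightarrow> 'a \<Rightarrow> real" where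
  "gromov_product w x y = (dist x w + dist y w - dist x y) / 2"

definition gromov_hyperbolic :: "'a::metric_space itself \<Rightarrow> bool" where
  "gromov_hyperbolic _ \<longleftrightarrow>
     (\<exists>\<delta>\<ge>0. \<forall>w x y z :: 'a.
        gromov_product w x z \<ge> min (gromov_product w x y) (gromov_product w y z) - \<delta>)"

definition isometric_action :: "('g, 'm) monoid_scheme \<Rightarrow> ('g \<Rightarrow> 'a \<Rightarrow> 'a::metric_space) \<Rightarrow> bool" where
  "isometric_action G \<phi> \<longleftrightarrow>
     group_action G UNIV \<phi> \<and> (\<forall>g \<in> carrier G. \<forall>x y. dist (\<phi> g x) (\<phi> g y) = dist x y)"

definition acylindrical_action :: "('g, 'm) monoid_scheme \<Rightarrow> ('g \<Rightarrow> 'a \<Rightarrow> 'a::metric_space) \<Rightarrow> bool" where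
  "acylindrical_action G \<phi> \<longleftrightarrow>
     isometric_action G \<phi> \<and>
     (\<exists>N \<kappa> :: real \<Rightarrow> real.
        (\<forall>r\<ge>0. N r \<ge> 0 \<and> \<kappa> r \<ge> 0) \<and>
        (\<forall>r\<ge>0. \<forall>x y. dist x y \<ge> \<kappa> r \<longrightarrow>
           (let S = {g \<in> carrier G. dist x (\<phi> g x) \<le> r \<and> dist y (\<phi> g y) \<le> r}
            in finite S \<and> real (card S) \<le> N r)))"

text \<open>The energy takes values in \<^typ>\<open>ennreal\<close>, so that it is meaningful for arbitrary \<open>U\<close>:
  it may be infinite when \<open>U\<close> is infinite, and it is 0 when \<open>U\<close> is empty.\<close>

definition linf_energy :: "('g \<Rightarrow> 'a \<Rightarrow> 'a::metric_space) \<Rightarrow> 'g set \<Rightarrow> ennreal" where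
  "linf_energy \<phi> U = (INF x. SUP u\<in>U. ennreal (dist (\<phi> u x) x))"

primrec set_power :: "('g, 'm) monoid_scheme \<Rightarrow> 'g set \<Rightarrow> nat \<Rightarrow> 'g set" where
  "set_power G U 0 = {\<one>\<^bsub>G\<^esub>}"
| "set_power G U (Suc r) = set_power G U r <#>\<^bsub>G\<^esub> U"

end

theory Submission
  imports Defs
begin

text \<open>Let \<open>x\<close> almost minimize the sum of the maximal and the mean displacement of \<open>U\<close>. One finds
  \<open>v \<in> U\<close> moving \<open>x\<close> far and a subset \<open>A\<close> of \<open>U\<close> of size comparable to \<open>|U|\<close> such that the broken
  lines through \<open>x\<close>, \<open>u\<^sub>1 v x\<close>, \<open>u\<^sub>1 v u\<^sub>2 v x\<close>, and so on, with all \<open>u\<^sub>i \<in> A\<close>, do not backtrack.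
  If many elements of \<open>U\<close> move \<open>x\<close> only a little, then \<open>v\<close> realizes the maximal displacement and, by
  acylindricity, only boundedly many of these elements produce backtracking. Otherwise backtracking
  can only be unavoidable if almost all of \<open>U\<close> leaves and enters \<open>x\<close> in one common direction and
  every element of large displacement does so at one end at least; then moving \<open>x\<close> in that
  direction would lower the energy.

  Two words with equal product but distinct first letters have first letters \<open>u v\<close>, \<open>u' v\<close> along a
  common geodesic from \<open>x\<close>. For given \<open>u\<close> and a given integer part of the displacement of \<open>u'\<close>,
  acylindricity leaves boundedly many \<open>u'\<close>, whence a subset of \<open>A\<close> of proportion at least a constant
  over \<open>\<lambda>(U)\<close> for which all words \<open>u\<^sub>1 v \<dots> u\<^sub>k v\<close> have different products.\<close>

section \<open>Length spaces and finite sets\<close>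

text \<open>Geodesics need not exist, so the point comes from the intermediate value theorem on a
  path of length below \<open>dist x y + \<epsilon>\<close>; the polygon inscribed at the times 0,
  \<open>t\<close>, 1 bounds the remaining distance.\<close>

lemma length_space_point_between:
  fixes x y :: "'a::metric_space"
  assumes "length_space TYPE('a)" "0 \<le> \<rho>" "\<rho> \<le> dist x y" "\<epsilon> > 0"
  obtains p where "dist x p = \<rho>" "dist p y \<le> dist x y - \<rho> + \<epsilon>"
proof -
  let ?P = "{p. path p \<and> pathstart p = x \<and> pathfinish p = y}"
  have "(INF p \<in> ?P. path_length p) < ennreal (dist x y + \<epsilon>)"
    using assms unfolding length_space_def by (metis ennreal_less_iff less_add_same_cancel1 zero_le_dist)
  then obtain c where c: "path c" "c 0 = x" "c 1 = y" "path_length c < ennreal (dist x y + \<epsilon>)"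
    unfolding INF_less_iff by (auto simp: pathstart_def pathfinish_def)
  have "continuous_on {0..1} (\<lambda>t. dist x (c t))"
    using c(1) unfolding path_def by (intro continuous_intros)
  then obtain t where t: "0 \<le> t" "t \<le> 1" "dist x (c t) = \<rho>"
    using IVT'[of "\<lambda>t. dist x (c t)" 0 \<rho> 1] c assms by auto
  have "(\<Sum>i < length [0,t,1] - 1. ennreal (dist (c ([0,t,1] ! i)) (c ([0,t,1] ! Suc i)))) \<le> path_length c"
    unfolding path_length_def using t by (intro SUP_upper) auto
  then have "ennreal (\<rho> + dist (c t) y) \<le> path_length c"
    using t c assms(2) by (simp add: lessThan_Suc numeral_2_eq_2 add.commute flip: ennreal_plus)
  then have "ennreal (\<rho> + dist (c t) y) < ennreal (dist x y + \<epsilon>)" using c(4) by order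
  then have "\<rho> + dist (c t) y < dist x y + \<epsilon>"
    using assms(2) ennreal_less_iff[of "\<rho> + dist (c t) y" "dist x y + \<epsilon>"] by simp
  with t show ?thesis by (intro that[of "c t"]) auto
qed

text \<open>Greedy choice: keep an element \<open>a\<close> with maximal \<open>f\<close>, discard
  its \<open>R\<close>-neighbours, and repeat. At such an \<open>a\<close> the hypothesis bounds all
  neighbours, since none has a larger value of \<open>f\<close>.\<close>

lemma exists_independent_subset:
  fixes f :: "'b \<Rightarrow> real" and B :: real
  assumes "finite A" and sym: "\<And>a b. R a b \<Longrightarrow> R b a" and refl: "\<And>a. R a a"
    and "\<And>a. a \<in> A \<Longrightarrow> real (card {b \<in> A. f b \<le> f a \<and> R a b}) \<le> B"
  obtains I where "I \<subseteq> A" "\<And>a b. a \<in> I \<Longrightarrow> b \<in> I \<Longrightarrow> a \<noteq> b \<Longrightarrow> \<not> R a b"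
    "real (card A) \<le> B * card I"
proof -
  have "\<exists>I\<subseteq>A. (\<forall>a\<in>I. \<forall>b\<in>I. a \<noteq> b \<longrightarrow> \<not> R a b) \<and> real (card A) \<le> B * card I"
    using assms(1,4)
  proof (induction A rule: finite_psubset_induct)
    case (psubset A)
    show ?case
    proof (cases "A = {}")
      case False
      have "Max (f ` A) \<in> f ` A" using psubset.hyps False by simp
      then obtain a where a: "a \<in> A" "f a = Max (f ` A)" by force
      then have max: "f b \<le> f a" if "b \<in> A" for b using psubset.hyps that by simp
      define N where "N = {b \<in> A. R a b}"
      have N: "real (card N) \<le> B"
        using psubset.prems[OF a(1)] max by (auto simp: N_def cong: conj_cong)
      have "a \<in> N" using a refl by (simp add: N_def)
      have "real (card {b \<in> A - N. f b \<le> f c \<and> R c b}) \<le> B" if "c \<in> A - N" for c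
      proof -
        have "card {b \<in> A - N. f b \<le> f c \<and> R c b} \<le> card {b \<in> A. f b \<le> f c \<and> R c b}"
          using psubset.hyps by (intro card_mono) auto
        then show ?thesis using psubset.prems[of c] that by force
      qed
      moreover have "A - N \<subset> A" using a \<open>a \<in> N\<close> by auto
      ultimately obtain I where I: "I \<subseteq> A - N" "\<forall>a\<in>I. \<forall>b\<in>I. a \<noteq> b \<longrightarrow> \<not> R a b"
        "real (card (A - N)) \<le> B * card I"
        using psubset.IH[of "A - N"] by auto
      have fin: "finite I" using I(1) psubset.hyps finite_subset by blast
      have "a \<notin> I" using I(1) \<open>a \<in> N\<close> by auto
      have "card A = card (A - N) + card N"
        using psubset.hyps by (simp add: N_def card_Diff_subset card_mono)
      then have "real (card A) \<le> B * card (insert a I)"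
        using I(3) N fin \<open>a \<notin> I\<close> by (simp add: algebra_simps)
      moreover have "\<not> R a b \<and> \<not> R b a" if "b \<in> I" for b
        using that I(1) sym unfolding N_def by blast
      ultimately show ?thesis
        using I a by (intro exI[of _ "insert a I"]) auto
    qed auto
  qed
  then show ?thesis using that by blast
qed

text \<open>Later \<open>f\<close> is the displacement of the base point and \<open>M\<close> is
  linear in the energy, so the number of unit bins, at most \<open>M + 1\<close>, is the source of
  the factor \<open>\<lambda>(U)\<close> in the theorem.\<close>

lemma card_le_of_unit_bins:
  fixes f :: "'b \<Rightarrow> real"
  assumes "finite A" "M \<ge> 0" "\<And>a. a \<in> A \<Longrightarrow> 0 \<le> f a \<and> f a \<le> M"
    and "\<And>a. a \<in> A \<Longrightarrow> real (card {b \<in> A. \<lfloor>f b\<rfloor> = \<lfloor>f a\<rfloor>}) \<le> N" "N \<ge> 0"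
  shows "real (card A) \<le> (M + 1) * N"
proof -
  let ?J = "{0..\<lfloor>M\<rfloor>}"
  have bin: "real (card {b \<in> A. \<lfloor>f b\<rfloor> = j}) \<le> N" for j
  proof (cases "\<exists>a\<in>A. \<lfloor>f a\<rfloor> = j")
    case False
    then have "{b \<in> A. \<lfloor>f b\<rfloor> = j} = {}" by auto
    then show ?thesis using assms(5) by (metis card.empty of_nat_0)
  qed (use assms(4) in auto)
  have "A \<subseteq> (\<Union>j\<in>?J. {b \<in> A. \<lfloor>f b\<rfloor> = j})"
    using assms(3) by (auto simp: floor_mono)
  then have "card A \<le> (\<Sum>j\<in>?J. card {b \<in> A. \<lfloor>f b\<rfloor> = j})"
    using assms(1) by (intro order_trans[OF card_mono card_UN_le]) auto
  then have "real (card A) \<le> (\<Sum>j\<in>?J. real (card {b \<in> A. \<lfloor>f b\<rfloor> = j}))"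
    by (metis of_nat_le_iff of_nat_sum)
  also have "\<dots> \<le> (\<Sum>j\<in>?J. N)" by (intro sum_mono bin)
  also have "\<dots> = (of_int \<lfloor>M\<rfloor> + 1) * N" using assms(2) by simp
  also have "\<dots> \<le> (M + 1) * N" using assms(5) by (intro mult_right_mono) auto
  finally show ?thesis .
qed

section \<open>Powers of subsets of a group\<close>

context group
begin

lemma set_power_subset_carrier: "A \<subseteq> carrier G \<Longrightarrow> set_power G A k \<subseteq> carrier G"
  by (induction k) (auto simp: set_mult_closed)

lemma set_power_Suc_left:
  assumes "A \<subseteq> carrier G"
  shows "set_power G A (Suc k) = A <#> set_power G A k"
proof (induction k)
  case 0
  show ?case using assms by (auto simp: set_mult_def) (metis l_one r_one subsetD)+
next
  case (Suc k)
  then show ?case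
    using assms set_power_subset_carrier[OF assms] by (simp add: set_mult_assoc)
qed

lemma finite_set_power: "finite A \<Longrightarrow> finite (set_power G A k)"
  by (induction k) (auto simp: set_mult_def)

lemma card_set_mult_singleton:
  assumes "A \<subseteq> carrier G" "g \<in> carrier G"
  shows "card (A <#> {g}) = card A"
proof -
  have "A <#> {g} = (\<lambda>a. a \<otimes> g) ` A" by (auto simp: set_mult_def)
  moreover have "inj_on (\<lambda>a. a \<otimes> g) A"
    using assms by (auto simp: inj_on_def subset_iff)
  ultimately show ?thesis by (simp add: card_image)
qed

lemma set_power_pairs_subset:
  assumes "U \<subseteq> carrier G" "B \<subseteq> U" "v \<in> U"
  shows "set_power G (B <#> {v}) k \<subseteq> set_power G U (2 * k)"
proof (induction k)
  case (Suc k)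
  have "set_power G (B <#> {v}) (Suc k) \<subseteq> set_power G U (2 * k) <#> (U <#> U)"
    using Suc assms by (auto simp: set_mult_def) blast
  also have "\<dots> = set_power G U (2 * Suc k)"
    using assms set_power_subset_carrier[OF assms(1)] by (simp add: set_mult_assoc)
  finally show ?case .
qed simp

text \<open>For even \<open>r\<close> the pairs use exactly \<open>r\<close> letters. For odd
  \<open>r\<close> they use \<open>r + 1\<close>, but all these words end in \<open>v\<close>, and
  right translation by \<open>v\<close> preserves cardinality.\<close>

lemma card_set_power_ge_pairs:
  assumes U: "finite U" "U \<subseteq> carrier G" and B: "B \<subseteq> U" and v: "v \<in> U"
  shows "card (set_power G (B <#> {v}) ((r + 1) div 2)) \<le> card (set_power G U r)"
proof (cases "even r")
  case True
  then have "2 * ((r + 1) div 2) = r" by simp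
  then show ?thesis
    using set_power_pairs_subset[OF U(2) B v, of "(r + 1) div 2"] U
    by (metis card_mono finite_set_power)
next
  case False
  then obtain k where r: "r = Suc (2 * k)" by (metis oddE Suc_eq_plus1)
  note carr = set_power_subset_carrier[OF U(2)]
  have "B \<subseteq> carrier G" "v \<in> carrier G" using U B v by auto
  have "set_power G (B <#> {v}) (Suc k) \<subseteq> set_power G U (2 * k) <#> (U <#> {v})"
    using set_power_pairs_subset[OF U(2) B v, of k] B by (simp add: mono_set_mult)
  also have "\<dots> = set_power G U r <#> {v}"
    using U carr \<open>v \<in> carrier G\<close> r by (simp add: set_mult_assoc)
  finally have "card (set_power G (B <#> {v}) (Suc k)) \<le> card (set_power G U r <#> {v})"
    using U finite_set_power[of U r] by (intro card_mono) (auto simp: set_mult_def)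
  then show ?thesis
    using r card_set_mult_singleton[OF carr \<open>v \<in> carrier G\<close>, of r] by simp
qed

end

section \<open>Broken lines in hyperbolic spaces\<close>

text \<open>A hyperbolicity constant may be enlarged; with \<open>\<delta> \<ge> 1\<close>,
  multiples of \<open>\<delta>\<close> also absorb absolute constants and the slack of
  near-geodesics.\<close>

locale hyperbolic_action = group G for G :: "('g, 'm) monoid_scheme" (structure) +
  fixes \<phi> :: "'g \<Rightarrow> 'a \<Rightarrow> 'a::metric_space" and \<delta> :: real
  assumes isometric: "isometric_action G \<phi>"
    and delta_ge_1: "\<delta> \<ge> 1"
    and hyperbolic: "\<And>w x y z :: 'a.
      gromov_product w x z \<ge> min (gromov_product w x y) (gromov_product w y z) - \<delta>"
begin

abbreviation gp where "gp \<equiv> gromov_product"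

lemma gp_commute: "gp w x y = gp w y x"
  by (simp add: gromov_product_def dist_commute)

lemma gp_le_dist: "gp w x y \<le> dist w x"
  using dist_triangle[of y w x] by (simp add: gromov_product_def dist_commute field_simps)

lemma four_point:
  fixes w x y z :: 'a
  shows "dist x z + dist y w \<le> max (dist x y + dist z w) (dist y z + dist x w) + 2 * \<delta>"
  using hyperbolic[of w x y z] unfolding gromov_product_def
  by (auto simp: min_def max_def dist_commute field_simps split: if_splits)

lemma action_mult: "g \<in> carrier G \<Longrightarrow> h \<in> carrier G \<Longrightarrow> \<phi> (g \<otimes> h) x = \<phi> g (\<phi> h x)"
  using isometric group_action.composition_rule[of G UNIV \<phi>] unfolding isometric_action_def by auto

lemma action_one: "\<phi> \<one> x = x"
  using isometric group_action.id_eq_one[of G UNIV \<phi>] unfolding isometric_action_def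
  by (metis UNIV_I restrict_apply')

lemma dist_action: "g \<in> carrier G \<Longrightarrow> dist (\<phi> g x) (\<phi> g y) = dist x y"
  using isometric unfolding isometric_action_def by auto

lemma action_inv: "g \<in> carrier G \<Longrightarrow> \<phi> g (\<phi> (inv g) x) = x" "g \<in> carrier G \<Longrightarrow> \<phi> (inv g) (\<phi> g x) = x"
  by (simp_all add: action_one flip: action_mult)

lemma dist_action_inv: "g \<in> carrier G \<Longrightarrow> dist x (\<phi> (inv g) y) = dist (\<phi> g x) y"
  using dist_action[of g x "\<phi> (inv g) y"] by (simp add: action_inv)

text \<open>In a triangle the Gromov products at the two ends of a side add up to its length. Here
  the side joins \<open>x\<close> to \<open>\<phi> g x\<close>, and \<open>inv g\<close> carries the
  product at its far end back to \<open>x\<close>.\<close>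

lemma gp_translate:
  assumes "g \<in> carrier G"
  shows "gp x (\<phi> g x) (\<phi> g y) = dist x (\<phi> g x) - gp x (\<phi> (inv g) x) y"
  using assms dist_action_inv[of g x x] dist_action_inv[of g y x] unfolding gromov_product_def
  by (simp add: dist_action dist_commute field_simps)

text \<open>A broken line with small Gromov products at its corners and long edges does not backtrack.\<close>

lemma gp_set_power_le:
  assumes W: "W \<subseteq> carrier G" and long: "\<And>w. w \<in> W \<Longrightarrow> dist x (\<phi> w x) > 2 * K + 2 * \<delta>"
    and corner: "\<And>w w'. w \<in> W \<Longrightarrow> w' \<in> W \<Longrightarrow> gp x (\<phi> (inv w) x) (\<phi> w' x) \<le> K" and "K \<ge> 0"
    and "w \<in> W" "h \<in> set_power G W k"
  shows "gp x (\<phi> (inv w) x) (\<phi> h x) \<le> K + \<delta>"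
  using assms(5,6)
proof (induction k arbitrary: w h)
  case 0
  then show ?case using \<open>K \<ge> 0\<close> delta_ge_1 by (simp add: action_one gromov_product_def)
next
  case (Suc k)
  then obtain a b where ab: "a \<in> W" "b \<in> set_power G W k" "h = a \<otimes> b"
    unfolding set_power_Suc_left[OF W] by (auto simp: set_mult_def)
  have carr: "a \<in> carrier G" "b \<in> carrier G" using ab W set_power_subset_carrier[OF W] by auto
  \<comment> \<open>By induction the rest of the line does not turn back at
    \<open>\<phi> a x\<close>, so the line to \<open>\<phi> h x\<close> follows the first edge for
    longer than \<open>K + \<delta>\<close>. The corner bound then transfers with a single loss of
    \<open>\<delta>\<close>, which does not accumulate with \<open>k\<close>.\<close>
  have "gp x (\<phi> a x) (\<phi> h x) > K + \<delta>"
    using gp_translate[OF carr(1), of x "\<phi> b x"] Suc.IH[OF ab(1,2)] long[OF ab(1)] ab carr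
    by (simp add: action_mult)
  then show ?case
    using hyperbolic[of x "\<phi> (inv w) x" "\<phi> h x" "\<phi> a x"] corner[OF Suc.prems(1) ab(1)]
    by (simp add: gp_commute min_def split: if_splits)
qed

text \<open>A product determines its word: the line to \<open>w \<otimes> h\<close> follows the edge
  to \<open>w\<close> almost to its end, so two different first letters of one product would violate
  separation. Cancelling the first letter gives the induction.\<close>

lemma card_set_power_separated:
  assumes W: "W \<subseteq> carrier G" and long: "\<And>w. w \<in> W \<Longrightarrow> dist x (\<phi> w x) > 2 * K + 2 * \<delta>"
    and corner: "\<And>w w'. w \<in> W \<Longrightarrow> w' \<in> W \<Longrightarrow> gp x (\<phi> (inv w) x) (\<phi> w' x) \<le> K" and "K \<ge> 0"
    and separated: "\<And>w w'. w \<in> W \<Longrightarrow> w' \<in> W \<Longrightarrow> w \<noteq> w' \<Longrightarrow>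
      gp x (\<phi> w x) (\<phi> w' x) < min (dist x (\<phi> w x)) (dist x (\<phi> w' x)) - (K + 2 * \<delta>)"
  shows "card (set_power G W k) = card W ^ k"
proof (induction k)
  case (Suc k)
  let ?P = "set_power G W k"
  note carr = set_power_subset_carrier[OF W, of k]
  have beyond: "gp x (\<phi> w x) (\<phi> (w \<otimes> h) x) \<ge> dist x (\<phi> w x) - (K + \<delta>)"
    if "w \<in> W" "h \<in> ?P" for w h
    using gp_translate[of w x "\<phi> h x"] gp_set_power_le[OF W long corner \<open>K \<ge> 0\<close> that] that W carr
    by (auto simp: action_mult subset_iff)
  have "inj_on (\<lambda>(w, h). w \<otimes> h) (W \<times> ?P)"
  proof (intro inj_onI, clarify)
    fix w h w' h' assume *: "w \<in> W" "h \<in> ?P" "w' \<in> W" "h' \<in> ?P" "w \<otimes> h = w' \<otimes> h'"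
    have "w = w'"
    proof (rule ccontr)
      assume "w \<noteq> w'"
      then show False
        using separated[of w w'] beyond[of w h] beyond[of w' h'] *
          hyperbolic[of x "\<phi> w x" "\<phi> (w \<otimes> h) x" "\<phi> w' x"]
        by (simp add: gp_commute min_def split: if_splits)
    qed
    moreover have "w \<in> carrier G" "h \<in> carrier G" "h' \<in> carrier G" using * W carr by auto
    ultimately show "w = w' \<and> h = h'" using * by simp
  qed
  moreover have "W <#> ?P = (\<lambda>(w, h). w \<otimes> h) ` (W \<times> ?P)" by (auto simp: set_mult_def)
  ultimately have "card (W <#> ?P) = card W * card ?P"
    by (simp add: card_image card_cartesian_product)
  then show ?case using Suc set_power_Suc_left[OF W] by simp
qed simp

section \<open>Words in the pairs \<open>u \<otimes> v\<close> with \<open>v\<close> fixed\<close>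

lemma corner_pair:
  assumes "u \<in> carrier G" "v \<in> carrier G" "gp x (\<phi> (inv u) x) (\<phi> v x) \<le> K"
    and "gp x (\<phi> (inv v) x) y \<le> K'" "dist x (\<phi> v x) > K + K' + \<delta>"
  shows "gp x (\<phi> (inv (u \<otimes> v)) x) y \<le> K' + \<delta>"
proof -
  have "\<phi> (inv (u \<otimes> v)) x = \<phi> (inv v) (\<phi> (inv u) x)"
    using assms by (simp add: inv_mult_group action_mult)
  moreover have "dist x (\<phi> (inv v) x) = dist x (\<phi> v x)"
    using assms(2) by (simp add: dist_action_inv dist_commute)
  \<comment> \<open>The small corner between \<open>inv u\<close> and \<open>v\<close> makes the
    lines from \<open>x\<close> towards its images under \<open>inv v\<close> and
    \<open>inv (u \<otimes> v)\<close> run together for longer than \<open>K' + \<delta>\<close>, so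
    the bound on the corner with \<open>y\<close> transfers.\<close>
  ultimately have "gp x (\<phi> (inv v) x) (\<phi> (inv (u \<otimes> v)) x) > K' + \<delta>"
    using gp_translate[of "inv v" x "\<phi> (inv u) x"] assms by (simp add: gp_commute)
  then show ?thesis
    using hyperbolic[of x "\<phi> (inv v) x" "\<phi> (inv (u \<otimes> v)) x" y] assms(4)
    by (simp add: min_def split: if_splits)
qed

text \<open>The elements \<open>inv a \<otimes> b\<close> are distinct and move both
  \<open>y\<close> and \<open>z\<close> by at most \<open>r\<close>. Thus acylindricity bounds sets
  of elements whose images of two distant points are close.\<close>

lemma card_nearby_le:
  assumes A: "A \<subseteq> carrier G" "a \<in> A"
    and "\<And>b. b \<in> A \<Longrightarrow> dist (\<phi> a y) (\<phi> b y) \<le> r"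
    and "\<And>b. b \<in> A \<Longrightarrow> dist (\<phi> a z) (\<phi> b z) \<le> r"
    and S: "finite {g \<in> carrier G. dist y (\<phi> g y) \<le> r \<and> dist z (\<phi> g z) \<le> r}"
  shows "card A \<le> card {g \<in> carrier G. dist y (\<phi> g y) \<le> r \<and> dist z (\<phi> g z) \<le> r}"
proof (rule card_inj_on_le)
  show "inj_on (\<lambda>b. inv a \<otimes> b) A" using A by (auto simp: inj_on_def subset_iff)
  show "(\<lambda>b. inv a \<otimes> b) ` A \<subseteq> {g \<in> carrier G. dist y (\<phi> g y) \<le> r \<and> dist z (\<phi> g z) \<le> r}"
    using assms by (auto simp: subset_iff action_mult dist_action_inv)
qed (rule S)

lemma dist_mult_bounds:
  assumes "u \<in> carrier G" "v \<in> carrier G" "gp x (\<phi> (inv u) x) (\<phi> v x) \<le> K"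
  shows "dist x (\<phi> (u \<otimes> v) x) \<ge> dist x (\<phi> u x) + dist x (\<phi> v x) - 2 * K"
    and "dist x (\<phi> (u \<otimes> v) x) \<le> dist x (\<phi> u x) + dist x (\<phi> v x)"
proof -
  have "dist (\<phi> (inv u) x) (\<phi> v x) = dist x (\<phi> (u \<otimes> v) x)"
    using assms dist_action_inv[of u "\<phi> v x" x] by (simp add: action_mult dist_commute)
  moreover have "dist x (\<phi> (inv u) x) = dist x (\<phi> u x)"
    using assms by (simp add: dist_action_inv dist_commute)
  ultimately show "dist x (\<phi> (u \<otimes> v) x) \<ge> dist x (\<phi> u x) + dist x (\<phi> v x) - 2 * K"
    using assms(3) by (simp add: gromov_product_def dist_commute)
  show "dist x (\<phi> (u \<otimes> v) x) \<le> dist x (\<phi> u x) + dist x (\<phi> v x)"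
    using dist_triangle[of x "\<phi> (u \<otimes> v) x" "\<phi> u x"] assms
    by (simp add: action_mult dist_action)
qed

text \<open>Words over an independent set for \<open>R\<close> have distinct products. Elements
  \<open>R\<close>-related to \<open>a\<close> and ending no further away have their edges along the
  line to \<open>p a\<close>; the integer part of the displacement locates them up to
  \<open>r\<close>, and acylindricity at \<open>x\<close> and \<open>\<phi> v x\<close> leaves at
  most \<open>N\<close> in each bin.\<close>

lemma pair_word_growth:
  assumes A: "finite A" "A \<subseteq> carrier G" and v: "v \<in> carrier G" and "K \<ge> 0" "M \<ge> 0"
    and far: "dist x (\<phi> v x) > 4 * K + 2 * \<delta>"
    and inner: "\<And>u. u \<in> A \<Longrightarrow> gp x (\<phi> (inv u) x) (\<phi> v x) \<le> K"
    and outer: "\<And>u u'. u \<in> A \<Longrightarrow> u' \<in> A \<Longrightarrow> gp x (\<phi> (inv (u \<otimes> v)) x) (\<phi> (u' \<otimes> v) x) \<le> K"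
    and M: "\<And>u. u \<in> A \<Longrightarrow> dist x (\<phi> u x) \<le> M"
    and r: "r = 4 * K + 8 * \<delta> + 1"
    and few: "finite {g \<in> carrier G. dist x (\<phi> g x) \<le> r \<and> dist (\<phi> v x) (\<phi> g (\<phi> v x)) \<le> r}"
      "real (card {g \<in> carrier G. dist x (\<phi> g x) \<le> r \<and> dist (\<phi> v x) (\<phi> g (\<phi> v x)) \<le> r}) \<le> N"
  obtains B where "B \<subseteq> A" "real (card A) \<le> (M + 1) * N * card B"
    "\<And>k. card (set_power G (B <#> {v}) k) = card B ^ k"
proof -
  have "N \<ge> 0" using few(2) by linarith
  define p where "p u = \<phi> (u \<otimes> v) x" for u
  have A_carr: "u \<in> carrier G" if "u \<in> A" for u using that A by auto
  have len: "dist x (p u) \<ge> dist x (\<phi> u x) + dist x (\<phi> v x) - 2 * K"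
    "dist x (p u) \<le> dist x (\<phi> u x) + dist x (\<phi> v x)" if "u \<in> A" for u
    using dist_mult_bounds[OF A_carr[OF that] v inner[OF that]] by (auto simp: p_def)
  define R where "R a b \<longleftrightarrow> gp x (p a) (p b) \<ge> min (dist x (p a)) (dist x (p b)) - (K + 2 * \<delta>)" for a b
  have near: "dist (\<phi> b x) (\<phi> c x) \<le> r \<and> dist (p b) (p c) \<le> r"
    if abc: "a \<in> A" "b \<in> A" "c \<in> A"
      and b: "dist x (p b) \<le> dist x (p a)" "R a b" and c: "dist x (p c) \<le> dist x (p a)" "R a c"
      and bin: "\<lfloor>dist x (\<phi> c x)\<rfloor> = \<lfloor>dist x (\<phi> b x)\<rfloor>" for a b c
  proof -
    have diff: "\<bar>dist x (\<phi> c x) - dist x (\<phi> b x)\<bar> \<le> 1" using bin by linarith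
    have ends: "gp x (p a) (p d) \<ge> dist x (p d) - (K + 2 * \<delta>)"
      "gp x (p a) (\<phi> d x) \<ge> dist x (\<phi> d x) - (K + 3 * \<delta>)"
      if d: "d \<in> A" "dist x (p d) \<le> dist x (p a)" "R a d" for d
    proof -
      show 1: "gp x (p a) (p d) \<ge> dist x (p d) - (K + 2 * \<delta>)"
        using d unfolding R_def by (simp add: min_def split: if_splits)
      have "gp x (p d) (\<phi> d x) \<ge> dist x (\<phi> d x) - K"
        using gp_translate[of d x "\<phi> v x"] d A_carr v inner[of d]
        by (simp add: p_def action_mult gp_commute)
      \<comment> \<open>The point \<open>\<phi> d x\<close> lies near the line to
        \<open>p d\<close>, well before its end because \<open>v\<close> moves \<open>x\<close> far,
        and hence near the line to \<open>p a\<close>.\<close>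
      then show "gp x (p a) (\<phi> d x) \<ge> dist x (\<phi> d x) - (K + 3 * \<delta>)"
        using 1 hyperbolic[of x "p a" "p d" "\<phi> d x"] len[OF d(1)] far \<open>K \<ge> 0\<close> delta_ge_1
        by (simp add: min_def split: if_splits)
    qed
    note eb = ends[OF abc(2) b] and ec = ends[OF abc(3) c]
    have "gp x (p b) (p c) \<ge> min (dist x (p b)) (dist x (p c)) - (K + 3 * \<delta>)"
      using hyperbolic[of x "p b" "p a" "p c"] eb ec
      by (simp add: gp_commute min_def split: if_splits)
    \<comment> \<open>The distances of \<open>p b\<close> and \<open>p c\<close> from
      \<open>x\<close> differ by at most \<open>2 * K + 1\<close>, and the product adds
      \<open>2 * K + 6 * \<delta>\<close>. For \<open>\<phi> b x\<close> and
      \<open>\<phi> c x\<close> the total is \<open>2 * K + 8 * \<delta> + 1\<close>;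
      \<open>r\<close> dominates both.\<close>
    then have "dist (p b) (p c) \<le> r"
      using len[OF abc(2)] len[OF abc(3)] diff delta_ge_1 \<open>K \<ge> 0\<close> unfolding r gromov_product_def
      by (simp add: min_def dist_commute split: if_splits)
    moreover have "gp x (\<phi> b x) (\<phi> c x) \<ge> min (dist x (\<phi> b x)) (dist x (\<phi> c x)) - (K + 4 * \<delta>)"
      using hyperbolic[of x "\<phi> b x" "p a" "\<phi> c x"] eb ec
      by (simp add: gp_commute min_def split: if_splits)
    then have "dist (\<phi> b x) (\<phi> c x) \<le> r"
      using diff delta_ge_1 \<open>K \<ge> 0\<close> unfolding r gromov_product_def
      by (simp add: min_def dist_commute split: if_splits)
    ultimately show ?thesis by simp
  qed
  have "real (card {b \<in> A. dist x (p b) \<le> dist x (p a) \<and> R a b}) \<le> (M + 1) * N" (is "real (card ?C) \<le> _")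
    if a: "a \<in> A" for a
  proof (rule card_le_of_unit_bins[where f = "\<lambda>u. dist x (\<phi> u x)"])
    show "real (card {c \<in> ?C. \<lfloor>dist x (\<phi> c x)\<rfloor> = \<lfloor>dist x (\<phi> b x)\<rfloor>}) \<le> N" if b: "b \<in> ?C" for b
    proof -
      have "card {c \<in> ?C. \<lfloor>dist x (\<phi> c x)\<rfloor> = \<lfloor>dist x (\<phi> b x)\<rfloor>} \<le>
        card {g \<in> carrier G. dist x (\<phi> g x) \<le> r \<and> dist (\<phi> v x) (\<phi> g (\<phi> v x)) \<le> r}"
      proof (rule card_nearby_le[OF _ _ _ _ few(1), where a = b])
        fix c assume c: "c \<in> {c \<in> ?C. \<lfloor>dist x (\<phi> c x)\<rfloor> = \<lfloor>dist x (\<phi> b x)\<rfloor>}"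
        have "dist (\<phi> b x) (\<phi> c x) \<le> r \<and> dist (p b) (p c) \<le> r"
          using a b c by (intro near[of a b c]) auto
        then show "dist (\<phi> b x) (\<phi> c x) \<le> r" "dist (\<phi> b (\<phi> v x)) (\<phi> c (\<phi> v x)) \<le> r"
          using b c A_carr v by (auto simp: p_def action_mult)
      qed (use b A_carr in auto)
      then show ?thesis using few(2) by linarith
    qed
  qed (use A M \<open>M \<ge> 0\<close> \<open>N \<ge> 0\<close> in auto)
  moreover have "R a b \<Longrightarrow> R b a" for a b
    unfolding R_def by (simp add: gp_commute min.commute)
  moreover have "R a a" for a
    unfolding R_def using \<open>K \<ge> 0\<close> delta_ge_1 by (simp add: gromov_product_def dist_commute)
  ultimately obtain B where B: "B \<subseteq> A" "\<And>a b. a \<in> B \<Longrightarrow> b \<in> B \<Longrightarrow> a \<noteq> b \<Longrightarrow> \<not> R a b"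
    "real (card A) \<le> (M + 1) * N * card B"
    using exists_independent_subset[of A R "\<lambda>u. dist x (p u)" "(M + 1) * N"] A(1) by blast
  have "B \<subseteq> carrier G" using A B by auto
  have W: "B <#> {v} = (\<lambda>u. u \<otimes> v) ` B" by (auto simp: set_mult_def)
  have "card (set_power G (B <#> {v}) k) = card (B <#> {v}) ^ k" for k
  proof (rule card_set_power_separated[where x = x and K = K])
    show "B <#> {v} \<subseteq> carrier G" using \<open>B \<subseteq> carrier G\<close> v by (auto simp: W)
    show "2 * K + 2 * \<delta> < dist x (\<phi> w x)" if "w \<in> B <#> {v}" for w
      using that len(1) far B(1) unfolding W p_def
      by (smt (verit) image_iff subset_iff zero_le_dist)
    show "gp x (\<phi> (inv w) x) (\<phi> w' x) \<le> K" if "w \<in> B <#> {v}" "w' \<in> B <#> {v}" for w w'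
      using that outer B(1) unfolding W by auto
    show "gp x (\<phi> w x) (\<phi> w' x) < min (dist x (\<phi> w x)) (dist x (\<phi> w' x)) - (K + 2 * \<delta>)"
      if "w \<in> B <#> {v}" "w' \<in> B <#> {v}" "w \<noteq> w'" for w w'
      using that B(2) unfolding W R_def p_def by force
  qed (fact \<open>K \<ge> 0\<close>)
  moreover have "card (B <#> {v}) = card B"
    using card_set_mult_singleton \<open>B \<subseteq> carrier G\<close> v by blast
  ultimately show ?thesis using that B by simp
qed

text \<open>Backtracking elements all send \<open>\<phi> v x\<close> in the direction of
  \<open>inv v\<close>. Hence the point \<open>q\<close> at distance \<open>\<kappa>\<close> on the
  way from \<open>x\<close> to \<open>\<phi> v x\<close> has nearby images under all of them, as has
  \<open>x\<close> because displacements are at most \<open>D\<close>. Acylindricity for the pair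
  \<open>x\<close>, \<open>q\<close> counts them.\<close>

lemma few_backtracking:
  assumes len: "length_space TYPE('a)" and V: "V \<subseteq> carrier G" and v: "v \<in> carrier G"
    and "\<And>u. u \<in> V \<Longrightarrow> dist x (\<phi> u x) \<le> D" "D \<ge> 0"
    and \<kappa>: "0 \<le> \<kappa>" "\<kappa> \<le> dist x (\<phi> v x)" and r: "r = 4 * D + 6 * \<delta>"
    and few: "\<And>y z. dist y z \<ge> \<kappa> \<Longrightarrow> finite {g \<in> carrier G. dist y (\<phi> g y) \<le> r \<and> dist z (\<phi> g z) \<le> r}
      \<and> real (card {g \<in> carrier G. dist y (\<phi> g y) \<le> r \<and> dist z (\<phi> g z) \<le> r}) \<le> N"
  shows "real (card {u \<in> V. gp x (\<phi> (inv v) x) (\<phi> (u \<otimes> v) x) > \<kappa>}) \<le> N" (is "real (card ?S) \<le> N")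
proof (cases "?S = {}")
  case True
  then show ?thesis using few[OF \<kappa>(2)] by (simp only: card.empty) linarith
next
  case False
  obtain q where q: "dist x q = \<kappa>" "dist q (\<phi> v x) \<le> dist x (\<phi> v x) - \<kappa> + \<delta>"
    using length_space_point_between[OF len \<kappa>, of \<delta>] delta_ge_1 by auto
  have along: "gp x (\<phi> u q) (\<phi> (u \<otimes> v) x) \<ge> \<kappa> - D - \<delta>"
    and close: "dist x (\<phi> u q) \<le> \<kappa> + D" if u: "u \<in> V" for u
  proof -
    have "u \<in> carrier G" "dist x (\<phi> u x) \<le> D" using assms u by auto
    moreover have "dist (\<phi> u x) (\<phi> u q) = \<kappa>" "dist (\<phi> u q) (\<phi> (u \<otimes> v) x) = dist q (\<phi> v x)"
      "dist (\<phi> u x) (\<phi> (u \<otimes> v) x) = dist x (\<phi> v x)"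
      using \<open>u \<in> carrier G\<close> v q by (simp_all add: dist_action action_mult)
    moreover note dist_triangle[of x "\<phi> u q" "\<phi> u x"] dist_triangle[of "\<phi> u x" "\<phi> u q" x]
      dist_triangle[of "\<phi> u x" "\<phi> (u \<otimes> v) x" x]
    ultimately show "gp x (\<phi> u q) (\<phi> (u \<otimes> v) x) \<ge> \<kappa> - D - \<delta>" "dist x (\<phi> u q) \<le> \<kappa> + D"
      using q delta_ge_1 unfolding gromov_product_def by (simp_all add: dist_commute)
  qed
  from False obtain a where a: "a \<in> ?S" by blast
  have "card ?S \<le> card {g \<in> carrier G. dist x (\<phi> g x) \<le> r \<and> dist q (\<phi> g q) \<le> r}"
  proof (rule card_nearby_le[where a = a])
    fix b assume b: "b \<in> ?S"
    have "dist (\<phi> a x) (\<phi> b x) \<le> 2 * D"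
      using a b assms(4)[of a] assms(4)[of b] dist_triangle[of "\<phi> a x" "\<phi> b x" x]
      by (simp add: dist_commute)
    then show "dist (\<phi> a x) (\<phi> b x) \<le> r" using r delta_ge_1 assms(5) by simp
    have "gp x (\<phi> (a \<otimes> v) x) (\<phi> (b \<otimes> v) x) \<ge> \<kappa> - \<delta>"
      using hyperbolic[of x "\<phi> (a \<otimes> v) x" "\<phi> (inv v) x" "\<phi> (b \<otimes> v) x"] a b
      by (simp add: gp_commute min_def split: if_splits)
    then have "gp x (\<phi> a q) (\<phi> (b \<otimes> v) x) \<ge> \<kappa> - D - 2 * \<delta>"
      using hyperbolic[of x "\<phi> a q" "\<phi> (a \<otimes> v) x" "\<phi> (b \<otimes> v) x"] along[of a] a assms(5) delta_ge_1
      by (simp add: min_def split: if_splits)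
    then have "gp x (\<phi> a q) (\<phi> b q) \<ge> \<kappa> - D - 3 * \<delta>"
      using hyperbolic[of x "\<phi> a q" "\<phi> (b \<otimes> v) x" "\<phi> b q"] along[of b] b assms(5) delta_ge_1
      by (simp add: gp_commute min_def split: if_splits)
    \<comment> \<open>Both images lie within \<open>\<kappa> + D\<close> of \<open>x\<close>, with
      product at least \<open>\<kappa> - D - 3 * \<delta>\<close>; the difference, doubled, is the
      value of \<open>r\<close>.\<close>
    then show "dist (\<phi> a q) (\<phi> b q) \<le> r"
      using close[of a] close[of b] a b r unfolding gromov_product_def by (simp add: dist_commute)
  qed (use a V few[of x q] q in auto)
  then show ?thesis using few[of x q] q by force
qed

section \<open>Transverse directions\<close>

text \<open>If \<open>f u\<close> and \<open>g u\<close> are the directions in which \<open>u\<close> leaves and enters the base point, then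
  either some \<open>v\<close> can be concatenated on both sides with a positive proportion of the elements
  without backtracking, or almost all elements leave and enter in one common direction. If the first
  alternative fails, averaging gives a direction \<open>g w\<close> in which many elements leave; all other
  configurations of the pair \<open>f u\<close>, \<open>g u\<close> relative to \<open>g w\<close> are then rare, because they
  would provide a suitable \<open>v\<close>.\<close>

lemma direction_dichotomy:
  fixes f g :: "'b \<Rightarrow> 'a"
  assumes W: "finite W" "W \<noteq> {}"
  obtains (transverse) v where "v \<in> W"
      "card W \<le> 32 * card {u \<in> W. gp x (g u) (f v) \<le> K + 3 * \<delta> \<and> gp x (f u) (g v) \<le> K + 3 * \<delta>}"
  | (aligned) w where "w \<in> W"
      "7 * card W \<le> 8 * card {u \<in> W. gp x (f u) (g w) > K \<and> gp x (g u) (g w) > K}"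
proof -
  define Good where "Good v = {u \<in> W. gp x (g u) (f v) \<le> K + 3 * \<delta> \<and> gp x (f u) (g v) \<le> K + 3 * \<delta>}" for v
  consider "\<exists>v\<in>W. card W \<le> 32 * card (Good v)" | "\<forall>v\<in>W. 32 * card (Good v) < card W"
    by (meson not_le)
  then show ?thesis
  proof cases
    case 1
    then show ?thesis using transverse unfolding Good_def by blast
  next
    case 2
    define P where "P u v \<longleftrightarrow> gp x (g u) (f v) > K + 3 * \<delta>" for u v
    define s where "s = (\<Sum>u\<in>W. card {v \<in> W. P u v})"
    have rare: "32 * card S < card W" if "v \<in> W" "S \<subseteq> Good v" for v S
    proof -
      have "card S \<le> card (Good v)"
        using that W by (intro card_mono) (auto simp: Good_def)
      then show ?thesis using 2 that by fastforce
    qed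
    have swap: "(\<Sum>v\<in>W. card {u \<in> W. P u v}) = s"
    proof -
      have "(\<Sum>v\<in>W. card {u \<in> W. P u v}) = (\<Sum>v\<in>W. \<Sum>u\<in>W. of_bool (P u v))"
        using W by (simp add: Int_def)
      also have "\<dots> = (\<Sum>u\<in>W. \<Sum>v\<in>W. of_bool (P u v))" by (rule sum.swap)
      also have "\<dots> = s" using W by (simp add: s_def Int_def)
      finally show ?thesis .
    qed
    \<comment> \<open>If \<open>u\<close> is not good for \<open>v\<close>, then
      \<open>P u v\<close> or \<open>P v u\<close>. Summed over \<open>v\<close>, both kinds total
      \<open>s\<close>, so on average \<open>P w v\<close> holds for at least 31/64 of the
      \<open>v\<close> in \<open>W\<close>.\<close>
    have "31 * card W \<le> 32 * (card {u \<in> W. P u v} + card {u \<in> W. P v u})" if v: "v \<in> W" for v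
    proof -
      have "W \<subseteq> Good v \<union> {u \<in> W. P u v} \<union> {u \<in> W. P v u}"
        unfolding Good_def P_def by (auto simp: gp_commute)
      then have "card W \<le> card (Good v \<union> {u \<in> W. P u v} \<union> {u \<in> W. P v u})"
        using W by (intro card_mono) (auto simp: Good_def)
      also have "\<dots> \<le> card (Good v) + card {u \<in> W. P u v} + card {u \<in> W. P v u}"
        by (meson add_mono card_Un_le order.trans order_refl)
      finally show ?thesis using 2 v by fastforce
    qed
    then have "(\<Sum>v\<in>W. 31 * card W) \<le> (\<Sum>v\<in>W. 32 * (card {u \<in> W. P u v} + card {u \<in> W. P v u}))"
      by (intro sum_mono)
    also have "\<dots> = 64 * s"
      using swap by (simp add: sum.distrib s_def flip: sum_distrib_left)
    finally have s: "(\<Sum>v\<in>W. 31 * card W) \<le> 64 * s" .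
    have "\<exists>w\<in>W. 31 * card W \<le> 64 * card {v \<in> W. P w v}"
    proof (rule ccontr)
      assume "\<not> ?thesis"
      then have "(\<Sum>w\<in>W. 64 * card {v \<in> W. P w v}) < (\<Sum>w\<in>W. 31 * card W)"
        using W by (intro sum_strict_mono) auto
      then show False using s by (simp add: s_def sum_distrib_left)
    qed
    then obtain w where w: "w \<in> W" "31 * card W \<le> 64 * card {v \<in> W. P w v}" by blast
    define a where "a = g w"
    have separate: "gp x p q \<le> L + \<delta>" if "gp x p a \<le> L" "gp x q a > L + \<delta>" for p q L
      using that hyperbolic[of x p q a] by (simp add: min_def split: if_splits)
    \<comment> \<open>If any two elements of \<open>S\<close> concatenate well, then
      \<open>S\<close> lies in \<open>Good v\<close> for each of its members
      \<open>v\<close>.\<close>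
    have mutual: "32 * card S < card W"
      if "S \<subseteq> W" "\<And>u v. u \<in> S \<Longrightarrow> v \<in> S \<Longrightarrow> gp x (g u) (f v) \<le> K + 3 * \<delta>" for S
    proof (cases "S = {}")
      case True
      then show ?thesis using W by (simp add: card_gt_0_iff)
    next
      case False
      then obtain v where "v \<in> S" by blast
      then show ?thesis
        using that by (intro rare[of v]) (auto simp: Good_def gp_commute)
    qed
    have "32 * card {v \<in> W. gp x (f v) a > K + 3 * \<delta> \<and> gp x (g v) a \<le> K + 2 * \<delta>} < card W"
      using separate[of _ "K + 2 * \<delta>"] by (intro mutual) (auto simp: algebra_simps)
    moreover have "{v \<in> W. P w v} = {v \<in> W. gp x (f v) a > K + 3 * \<delta>}"
      unfolding P_def a_def by (simp add: gp_commute)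
    \<comment> \<open>As 31/64 exceeds 1/32, some \<open>v\<close> has both directions towards
      \<open>a\<close>. Elements of \<open>?S3\<close> below, with neither direction towards
      \<open>a\<close>, are then good for this \<open>v\<close>.\<close>
    ultimately have "{v \<in> W. gp x (f v) a > K + 3 * \<delta>} \<noteq>
        {v \<in> W. gp x (f v) a > K + 3 * \<delta> \<and> gp x (g v) a \<le> K + 2 * \<delta>}"
      using w(2) by (intro notI) simp
    then obtain v where v: "v \<in> W" "gp x (f v) a > K + 3 * \<delta>" "gp x (g v) a > K + 2 * \<delta>"
      by (metis (mono_tags, lifting) not_le)
    let ?S1 = "{u \<in> W. gp x (f u) a \<le> K \<and> gp x (g u) a > K + \<delta>}"
    let ?S2 = "{u \<in> W. gp x (g u) a \<le> K \<and> gp x (f u) a > K + \<delta>}"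
    let ?S3 = "{u \<in> W. gp x (f u) a \<le> K + \<delta> \<and> gp x (g u) a \<le> K + \<delta>}"
    let ?T = "{u \<in> W. gp x (f u) a > K \<and> gp x (g u) a > K}"
    have "32 * card ?S1 < card W"
      using separate[of _ K] delta_ge_1 by (intro mutual) (fastforce simp: gp_commute)+
    moreover have "32 * card ?S2 < card W"
      using separate[of _ K] delta_ge_1 by (intro mutual) fastforce+
    moreover have "32 * card ?S3 < card W"
    proof (intro rare[OF v(1)] subsetI)
      fix u assume "u \<in> ?S3"
      then show "u \<in> Good v"
        using separate[where p = "g u" and L = "K + \<delta>" and q = "f v"]
          separate[where p = "f u" and L = "K + \<delta>" and q = "g v"] v delta_ge_1
        by (simp add: Good_def)
    qed
    moreover have "card W \<le> card ?S1 + card ?S2 + card ?S3 + card ?T"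
    proof -
      have "W \<subseteq> ?S1 \<union> ?S2 \<union> ?S3 \<union> ?T" using delta_ge_1 by auto
      then have "card W \<le> card (?S1 \<union> ?S2 \<union> ?S3 \<union> ?T)" using W by (intro card_mono) auto
      also have "\<dots> \<le> card ?S1 + card ?S2 + card ?S3 + card ?T"
        by (meson add_mono card_Un_le order.trans order_refl)
      finally show ?thesis .
    qed
    \<comment> \<open>Each exceptional set is below 1/32 of \<open>W\<close>, and 29/32 exceeds
      7/8.\<close>
    ultimately have "7 * card W \<le> 8 * card ?T" by linarith
    then show ?thesis using aligned[OF w(1)] by (simp add: a_def)
  qed
qed

section \<open>Displacements and energy after moving the base point\<close>

lemma dist_toward:
  fixes x p q a :: 'a
  assumes "dist x p = \<rho>" "dist p a \<le> dist x a - \<rho> + \<delta>" "gp x q a \<ge> \<rho> - \<delta>"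
  shows "dist p q \<le> dist x q - \<rho> + 4 * \<delta>"
proof -
  \<comment> \<open>Both \<open>p\<close> and \<open>q\<close> share with \<open>a\<close> an
    initial segment of length about \<open>\<rho>\<close>, hence also with each other.\<close>
  have "gp x p a \<ge> \<rho> - \<delta>"
    using assms(1,2) delta_ge_1 by (simp add: gromov_product_def dist_commute)
  then have "gp x p q \<ge> \<rho> - 2 * \<delta>"
    using hyperbolic[of x p a q] assms(3) by (simp add: gp_commute min_def split: if_splits)
  then show ?thesis using assms(1) by (simp add: gromov_product_def dist_commute)
qed

text \<open>The four-point condition bounds the new displacement by the mixed distances, from
  \<open>x\<close> to \<open>\<phi> g p\<close> and from \<open>p\<close> to
  \<open>\<phi> g x\<close>. A direction of \<open>g\<close> towards \<open>a\<close> shortens one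
  of them by about \<open>\<rho>\<close>; in any case each grows by at most \<open>\<rho>\<close>,
  so one such direction already balances the other.\<close>

lemma displacement_toward:
  assumes g: "g \<in> carrier G" and p: "dist x p = \<rho>" "dist p a \<le> dist x a - \<rho> + \<delta>"
  shows displacement_toward_both:
      "gp x (\<phi> g x) a \<ge> \<rho> - \<delta> \<Longrightarrow> gp x (\<phi> (inv g) x) a \<ge> \<rho> - \<delta> \<Longrightarrow> dist x (\<phi> g x) \<ge> 2 * \<rho> \<Longrightarrow>
        dist p (\<phi> g p) \<le> dist x (\<phi> g x) - 2 * \<rho> + 10 * \<delta>"
    and displacement_toward_one:
      "gp x (\<phi> g x) a \<ge> \<rho> - \<delta> \<or> gp x (\<phi> (inv g) x) a \<ge> \<rho> - \<delta> \<Longrightarrow> dist x (\<phi> g x) \<ge> \<rho> \<Longrightarrow>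
        dist p (\<phi> g p) \<le> dist x (\<phi> g x) + 6 * \<delta>"
    and displacement_le: "dist p (\<phi> g p) \<le> dist x (\<phi> g x) + 2 * \<rho>"
proof -
  have inverse: "dist p (\<phi> (inv g) x) = dist x (\<phi> g p)" "dist x (\<phi> (inv g) x) = dist x (\<phi> g x)"
    using g by (simp_all add: dist_action_inv dist_commute)
  have iso: "dist (\<phi> g x) (\<phi> g p) = \<rho>" using g p by (simp add: dist_action)
  have four: "dist p (\<phi> g p) + dist x (\<phi> g x) \<le> max (2 * \<rho>) (dist x (\<phi> g p) + dist p (\<phi> g x)) + 2 * \<delta>"
    using four_point[of p "\<phi> g p" x "\<phi> g x"] iso p(1) by (simp add: dist_commute)
  have triangle: "dist x (\<phi> g p) \<le> dist x (\<phi> g x) + \<rho>" "dist p (\<phi> g x) \<le> dist x (\<phi> g x) + \<rho>"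
    using dist_triangle[of x "\<phi> g p" "\<phi> g x"] dist_triangle[of p "\<phi> g x" x] iso p(1)
    by (simp_all add: dist_commute)
  show "dist p (\<phi> g p) \<le> dist x (\<phi> g x) + 2 * \<rho>"
    using dist_triangle[of p "\<phi> g p" x] triangle p(1) by (simp add: dist_commute)
  show "dist p (\<phi> g p) \<le> dist x (\<phi> g x) - 2 * \<rho> + 10 * \<delta>"
    if "gp x (\<phi> g x) a \<ge> \<rho> - \<delta>" "gp x (\<phi> (inv g) x) a \<ge> \<rho> - \<delta>" "dist x (\<phi> g x) \<ge> 2 * \<rho>"
    using dist_toward[OF p that(1)] dist_toward[OF p that(2)] inverse four that(3) delta_ge_1
    by (simp add: max_def split: if_splits)
  show "dist p (\<phi> g p) \<le> dist x (\<phi> g x) + 6 * \<delta>"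
    if "gp x (\<phi> g x) a \<ge> \<rho> - \<delta> \<or> gp x (\<phi> (inv g) x) a \<ge> \<rho> - \<delta>" "dist x (\<phi> g x) \<ge> \<rho>"
    using that(1)
  proof
    assume "gp x (\<phi> g x) a \<ge> \<rho> - \<delta>"
    from dist_toward[OF p this] show ?thesis
      using inverse four that(2) triangle delta_ge_1 by (simp add: max_def split: if_splits)
  next
    assume "gp x (\<phi> (inv g) x) a \<ge> \<rho> - \<delta>"
    from dist_toward[OF p this] show ?thesis
      using inverse four that(2) triangle delta_ge_1 by (simp add: max_def split: if_splits)
  qed
qed

definition max_displacement :: "'g set \<Rightarrow> 'a \<Rightarrow> real" where
  "max_displacement U y = Max ((\<lambda>u. dist y (\<phi> u y)) ` U)"

text \<open>The mean displacement is added because the maximal displacement alone may stay constant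
  along the axis of a single element of \<open>U\<close>.\<close>

definition energy :: "'g set \<Rightarrow> 'a \<Rightarrow> real" where
  "energy U y = max_displacement U y + (\<Sum>u\<in>U. dist y (\<phi> u y)) / card U"

lemma max_displacement_ge: "finite U \<Longrightarrow> u \<in> U \<Longrightarrow> dist y (\<phi> u y) \<le> max_displacement U y"
  by (simp add: max_displacement_def)

lemma max_displacement_attained:
  assumes "finite U" "U \<noteq> {}"
  obtains u where "u \<in> U" "dist y (\<phi> u y) = max_displacement U y"
proof -
  have "max_displacement U y \<in> (\<lambda>u. dist y (\<phi> u y)) ` U"
    unfolding max_displacement_def using assms by (intro Max_in) auto
  then show ?thesis using that by force
qed

text \<open>Moving \<open>x\<close> by \<open>16 * \<delta>\<close> towards \<open>a\<close> lowers
  displacements in \<open>T\<close> by at least \<open>22 * \<delta>\<close> and raises the others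
  by at most \<open>32 * \<delta>\<close>. As \<open>T\<close> is at least 3/4 of \<open>U\<close>,
  the mean falls by at least \<open>8 * \<delta>\<close>, while the maximum rises by at most
  \<open>6 * \<delta>\<close>.\<close>

lemma energy_drop:
  assumes len: "length_space TYPE('a)" and U: "finite U" "U \<subseteq> carrier G" "U \<noteq> {}"
    and a: "16 * \<delta> \<le> dist x a" and m: "64 * \<delta> \<le> max_displacement U x"
    and T: "T \<subseteq> U" "3 * card U \<le> 4 * card T"
    and both: "\<And>u. u \<in> T \<Longrightarrow> gp x (\<phi> u x) a \<ge> 15 * \<delta> \<and> gp x (\<phi> (inv u) x) a \<ge> 15 * \<delta> \<and>
      dist x (\<phi> u x) \<ge> 32 * \<delta>"
    and one: "\<And>v. v \<in> U \<Longrightarrow> dist x (\<phi> v x) \<ge> max_displacement U x - 48 * \<delta> \<Longrightarrow>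
      gp x (\<phi> v x) a \<ge> 15 * \<delta> \<or> gp x (\<phi> (inv v) x) a \<ge> 15 * \<delta>"
  obtains p where "energy U p < energy U x - 1"
proof -
  obtain p where p: "dist x p = 16 * \<delta>" "dist p a \<le> dist x a - 16 * \<delta> + \<delta>"
    using length_space_point_between[OF len _ a, of \<delta>] delta_ge_1 by auto
  let ?d = "\<lambda>u. dist x (\<phi> u x)" and ?d' = "\<lambda>u. dist p (\<phi> u p)"
  have carr: "u \<in> carrier G" if "u \<in> U" for u using that U by auto
  have "?d' v \<le> max_displacement U x + 6 * \<delta>" if v: "v \<in> U" for v
  proof (cases "?d v \<ge> max_displacement U x - 48 * \<delta>")
    case True
    then show ?thesis
      using displacement_toward_one[OF carr[OF v] p] one[OF v] max_displacement_ge[OF U(1) v, of x]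
        m delta_ge_1 by simp
  next
    case False
    then show ?thesis using displacement_le[OF carr[OF v] p] delta_ge_1 by simp
  qed
  then have max: "max_displacement U p \<le> max_displacement U x + 6 * \<delta>"
    using max_displacement_attained[OF U(1,3), of p] by metis
  have "(\<Sum>u\<in>U. ?d' u) \<le> (\<Sum>u\<in>U. ?d u + 32 * \<delta> - (if u \<in> T then 54 * \<delta> else 0))"
  proof (rule sum_mono)
    fix u assume u: "u \<in> U"
    show "?d' u \<le> ?d u + 32 * \<delta> - (if u \<in> T then 54 * \<delta> else 0)"
      using displacement_le[OF carr[OF u] p] displacement_toward_both[OF carr[OF u] p] both[of u]
      by auto
  qed
  also have "\<dots> = (\<Sum>u\<in>U. ?d u) + 32 * \<delta> * card U - 54 * \<delta> * card T"
    using U(1) T(1) by (simp add: sum.distrib sum_subtractf sum.If_cases Int_absorb1)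
  also have "\<dots> \<le> (\<Sum>u\<in>U. ?d u) - 8 * \<delta> * card U"
  proof -
    have "\<delta> * (3 * real (card U)) \<le> \<delta> * (4 * real (card T))"
      using T(2) delta_ge_1 by (intro mult_left_mono) (simp_all flip: of_nat_mult)
    moreover have "\<delta> * real (card U) \<ge> 0" using delta_ge_1 by simp
    ultimately show ?thesis by simp
  qed
  finally have "(\<Sum>u\<in>U. ?d' u) / card U \<le> ((\<Sum>u\<in>U. ?d u) - 8 * \<delta> * card U) / card U"
    by (intro divide_right_mono) auto
  also have "\<dots> = (\<Sum>u\<in>U. ?d u) / card U - 8 * \<delta>"
    using U by (simp add: diff_divide_distrib)
  finally have "energy U p < energy U x - 1"
    unfolding energy_def using max delta_ge_1 by linarith
  then show ?thesis using that by blast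
qed

text \<open>The dichotomy is applied to the elements moving \<open>x\<close> by more than
  \<open>D\<close>. In the aligned case near-minimality rules out \<open>energy_drop\<close>, so
  some \<open>v\<close> of almost maximal displacement avoids the common direction at both ends and
  is transverse to all of \<open>T\<close>.\<close>

lemma transverse_family:
  assumes len: "length_space TYPE('a)" and U: "finite U" "U \<subseteq> carrier G" "U \<noteq> {}"
    and minimal: "\<And>y. energy U x \<le> energy U y + 1"
    and D: "64 * \<delta> \<le> D" "D + 48 * \<delta> \<le> max_displacement U x"
    and short: "8 * card {u \<in> U. dist x (\<phi> u x) \<le> D} \<le> card U"
  obtains v A where "v \<in> U" "A \<subseteq> U" "card U \<le> 64 * card A" "D \<le> dist x (\<phi> v x)"
    "\<And>u. u \<in> A \<Longrightarrow> D < dist x (\<phi> u x)"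
    "\<And>u. u \<in> A \<Longrightarrow> gp x (\<phi> (inv u) x) (\<phi> v x) \<le> 19 * \<delta>"
    "\<And>u. u \<in> A \<Longrightarrow> gp x (\<phi> u x) (\<phi> (inv v) x) \<le> 19 * \<delta>"
proof -
  define W where "W = {u \<in> U. D < dist x (\<phi> u x)}"
  have "U = {u \<in> U. dist x (\<phi> u x) \<le> D} \<union> W" by (auto simp: W_def)
  then have "card U \<le> card {u \<in> U. dist x (\<phi> u x) \<le> D} + card W" by (metis card_Un_le)
  then have W_large: "7 * card U \<le> 8 * card W" using short by linarith
  moreover have "card U > 0" using U by (simp add: card_gt_0_iff)
  ultimately have "card W \<noteq> 0" by linarith
  then have W: "finite W" "W \<noteq> {}" using U(1) by (auto simp: W_def)
  show ?thesis
  proof (rule direction_dichotomy[OF W, of x "\<lambda>u. \<phi> (inv u) x" "\<lambda>u. \<phi> u x" "16 * \<delta>"])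
    fix v
    let ?A = "{u \<in> W. gp x (\<phi> (inv u) x) (\<phi> v x) \<le> 16 * \<delta> + 3 * \<delta> \<and> gp x (\<phi> u x) (\<phi> (inv v) x) \<le> 16 * \<delta> + 3 * \<delta>}"
    assume "v \<in> W" "card W \<le> 32 * card ?A"
    moreover have "card U \<le> 64 * card ?A" using calculation W_large by linarith
    ultimately show ?thesis by (intro that[of v ?A]) (auto simp: W_def)
  next
    fix w
    define a where "a = \<phi> (inv w) x"
    define T where "T = {u \<in> W. gp x (\<phi> u x) a > 16 * \<delta> \<and> gp x (\<phi> (inv u) x) a > 16 * \<delta>}"
    assume w: "w \<in> W" and "7 * card W \<le> 8 * card {u \<in> W. gp x (\<phi> u x) (\<phi> (inv w) x) > 16 * \<delta> \<and>
      gp x (\<phi> (inv u) x) (\<phi> (inv w) x) > 16 * \<delta>}"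
    then have T_large: "7 * card W \<le> 8 * card T" by (simp add: T_def a_def)
    have "dist x a = dist x (\<phi> w x)"
      using w U unfolding a_def W_def by (auto simp: dist_action_inv dist_commute)
    then have a: "16 * \<delta> \<le> dist x a" using w D delta_ge_1 by (simp add: W_def)
    have "\<exists>v\<in>U. dist x (\<phi> v x) \<ge> max_displacement U x - 48 * \<delta> \<and>
      gp x (\<phi> v x) a < 15 * \<delta> \<and> gp x (\<phi> (inv v) x) a < 15 * \<delta>"
    proof (rule ccontr)
      assume no: "\<not> ?thesis"
      obtain p where "energy U p < energy U x - 1"
      proof (rule energy_drop[OF len U a, of T])
        \<comment> \<open>The two proportions 7/8 multiply to 49/64, which exceeds 3/4.\<close>
        show "3 * card U \<le> 4 * card T" using W_large T_large by linarith
      qed (use D no delta_ge_1 in \<open>auto simp: T_def W_def not_less\<close>)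
      then show False using minimal[of p] by linarith
    qed
    then obtain v where v: "v \<in> U" "dist x (\<phi> v x) \<ge> max_displacement U x - 48 * \<delta>"
      "gp x (\<phi> v x) a < 15 * \<delta>" "gp x (\<phi> (inv v) x) a < 15 * \<delta>" by blast
    have apart: "gp x p q \<le> 19 * \<delta>" if "gp x p a > 16 * \<delta>" "gp x q a < 15 * \<delta>" for p q
      using hyperbolic[of x q p a] that delta_ge_1 by (simp add: gp_commute min_def split: if_splits)
    show ?thesis
    proof (rule that[of v T])
      show "card U \<le> 64 * card T" using W_large T_large by linarith
    qed (use v D apart in \<open>auto simp: T_def W_def\<close>)
  qed
qed

end

section \<open>Product set growth\<close>

lemma exists_near_minimizer:
  fixes E :: "'b \<Rightarrow> real"
  assumes "\<And>x. 0 \<le> E x"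
  obtains x where "\<And>y. E x \<le> E y + 1"
proof -
  have bdd: "bdd_below (range E)" using assms by (intro bdd_belowI[of _ 0]) auto
  have "Inf (range E) < Inf (range E) + 1" by simp
  then obtain x where "E x < Inf (range E) + 1"
    using cInf_lessD[of "range E" "Inf (range E) + 1"] by auto
  moreover have "Inf (range E) \<le> E y" for y using bdd by (simp add: cInf_lower)
  ultimately have "E x \<le> E y + 1" for y by (smt (verit))
  then show ?thesis using that by blast
qed

lemma linf_energy_finite:
  fixes \<phi> :: "'g \<Rightarrow> 'a \<Rightarrow> 'a::metric_space"
  assumes U: "finite U" "U \<noteq> {}"
  defines "L \<equiv> enn2real (linf_energy \<phi> U)"
  shows "linf_energy \<phi> U = ennreal L"
    and "\<exists>u\<in>U. L \<le> dist y (\<phi> u y)"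
    and "\<exists>z. \<forall>u\<in>U. dist z (\<phi> u z) \<le> L + 1"
proof -
  have le: "linf_energy \<phi> U \<le> ennreal (Max ((\<lambda>u. dist y (\<phi> u y)) ` U))" for y
    unfolding linf_energy_def
    by (rule INF_lower2[of y]) (auto intro!: SUP_least ennreal_leI simp: U dist_commute)
  then show eq: "linf_energy \<phi> U = ennreal L"
    unfolding L_def by (metis ennreal_enn2real ennreal_less_top order_le_less_trans)
  have "Max ((\<lambda>u. dist y (\<phi> u y)) ` U) \<in> (\<lambda>u. dist y (\<phi> u y)) ` U" using U by simp
  moreover have "L \<le> Max ((\<lambda>u. dist y (\<phi> u y)) ` U)"
    using le[of y] calculation unfolding eq by (subst (asm) ennreal_le_iff) auto
  ultimately show "\<exists>u\<in>U. L \<le> dist y (\<phi> u y)" by auto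
  have "0 \<le> L" by (simp add: L_def)
  have "linf_energy \<phi> U < ennreal (L + 1)" unfolding eq using \<open>0 \<le> L\<close> by (simp add: ennreal_less_iff)
  then obtain z where z: "(SUP u\<in>U. ennreal (dist (\<phi> u z) z)) < ennreal (L + 1)"
    unfolding linf_energy_def INF_less_iff by blast
  have "dist z (\<phi> u z) \<le> L + 1" if "u \<in> U" for u
  proof -
    have "ennreal (dist (\<phi> u z) z) < ennreal (L + 1)" using z that by (meson SUP_lessD)
    then show ?thesis by (simp add: ennreal_less_iff dist_commute)
  qed
  then show "\<exists>z. \<forall>u\<in>U. dist z (\<phi> u z) \<le> L + 1" by blast
qed

context hyperbolic_action
begin

lemma freely_growing_pairs:
  fixes N \<kappa> :: "real \<Rightarrow> real"
  assumes len: "length_space TYPE('a)"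
    and nonneg: "\<And>r. r \<ge> 0 \<Longrightarrow> N r \<ge> 0 \<and> \<kappa> r \<ge> 0"
    and few: "\<And>r y z. r \<ge> 0 \<Longrightarrow> \<kappa> r \<le> dist y z \<Longrightarrow>
      finite {g \<in> carrier G. dist y (\<phi> g y) \<le> r \<and> dist z (\<phi> g z) \<le> r} \<and>
      real (card {g \<in> carrier G. dist y (\<phi> g y) \<le> r \<and> dist z (\<phi> g z) \<le> r}) \<le> N r"
  shows "\<exists>C\<ge>1. \<forall>U L. finite U \<longrightarrow> U \<subseteq> carrier G \<longrightarrow> linf_energy \<phi> U = ennreal L \<longrightarrow> C < L \<longrightarrow> C < card U \<longrightarrow>
      (\<exists>v\<in>U. \<exists>B\<subseteq>U. real (card U) \<le> C * L * card B \<and>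
        (\<forall>k. card (set_power G (B <#> {v}) k) = card B ^ k))"
proof -
  \<comment> \<open>\<open>K\<close> and \<open>r\<close> serve the transverse case, and
    \<open>D\<close> exceeds both the edge length required there and \<open>\<kappa> r\<close>. With
    many short elements, \<open>r1\<close> is the radius for \<open>few_backtracking\<close>, and
    \<open>K2\<close>, \<open>r2\<close> replace \<open>K\<close>, \<open>r\<close>: there the
    corners are at most \<open>D\<close> and \<open>\<kappa> r1 + \<delta>\<close>.\<close>
  define K where "K = 21 * \<delta>"
  define r where "r = 4 * K + 8 * \<delta> + 1"
  define D where "D = 100 * \<delta> + \<kappa> r"
  define r1 where "r1 = 4 * D + 6 * \<delta>"
  define K2 where "K2 = D + \<kappa> r1 + \<delta>"
  define r2 where "r2 = 4 * K2 + 8 * \<delta> + 1"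
  define Nmax where "Nmax = max (N r) (N r2)"
  \<comment> \<open>The bracket puts the maximal displacement above every length threshold;
    \<open>16 * N r1\<close> keeps backtracking elements to at most 1/16 of \<open>U\<close>; 384 is
    64 times 6, from \<open>card U \<le> 64 * card A\<close> and
    \<open>M + 1 \<le> 6 * L\<close>.\<close>
  define C where "C = 1 + (4 * K2 + 50 * \<delta> + \<kappa> r2) + 16 * N r1 + 384 * Nmax"
  have "r \<ge> 0" unfolding r_def K_def using delta_ge_1 by simp
  then have "\<kappa> r \<ge> 0" "D \<ge> 0" using nonneg[of r] delta_ge_1 by (auto simp: D_def)
  then have "r1 \<ge> 0" using delta_ge_1 by (simp add: r1_def)
  then have "\<kappa> r1 \<ge> 0" "N r1 \<ge> 0" "K2 \<ge> 0"
    using nonneg[of r1] delta_ge_1 \<open>D \<ge> 0\<close> by (auto simp: K2_def)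
  then have "r2 \<ge> 0" using delta_ge_1 by (simp add: r2_def)
  then have "\<kappa> r2 \<ge> 0" using nonneg by simp
  have "Nmax \<ge> 0" using nonneg[OF \<open>r \<ge> 0\<close>] by (simp add: Nmax_def max_def)
  have C: "1 \<le> C" "4 * K2 + 50 * \<delta> + \<kappa> r2 \<le> C" "16 * N r1 \<le> C" "384 * Nmax \<le> C"
    using \<open>K2 \<ge> 0\<close> delta_ge_1 \<open>\<kappa> r2 \<ge> 0\<close> \<open>N r1 \<ge> 0\<close> \<open>Nmax \<ge> 0\<close> by (simp_all add: C_def)
  have "\<exists>v\<in>U. \<exists>B\<subseteq>U. real (card U) \<le> C * L * card B \<and>
        (\<forall>k. card (set_power G (B <#> {v}) k) = card B ^ k)"
    if U: "finite U" "U \<subseteq> carrier G" and L_eq: "linf_energy \<phi> U = ennreal L" and L: "C < L"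
      and large: "C < card U" for U L
  proof -
    have "U \<noteq> {}" using large C(1) by auto
    have L_real: "enn2real (linf_energy \<phi> U) = L" using L_eq L C(1) by simp
    note linf = linf_energy_finite(2,3)[OF U(1) \<open>U \<noteq> {}\<close>, of \<phi>, unfolded L_real]
    have "0 \<le> energy U y" for y
    proof -
      have "0 \<le> max_displacement U y"
        using max_displacement_attained[OF U(1) \<open>U \<noteq> {}\<close>, of y] by (metis zero_le_dist)
      then show ?thesis unfolding energy_def by (simp add: sum_nonneg)
    qed
    then obtain x where x: "\<And>y. energy U x \<le> energy U y + 1"
      using exists_near_minimizer[of "energy U"] by blast
    \<comment> \<open>Some point has all displacements at most \<open>L + 1\<close>, hence energy at
      most \<open>2 * L + 2\<close>; near-minimality of \<open>x\<close> adds 1.\<close>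
    define M where "M = 2 * L + 3"
    have M_ge: "L \<le> max_displacement U x"
      using linf(1)[of x] max_displacement_ge[OF U(1)] by (meson order_trans)
    have M_le: "dist x (\<phi> u x) \<le> M" if "u \<in> U" for u
    proof -
      obtain z where z: "\<forall>u\<in>U. dist z (\<phi> u z) \<le> L + 1" using linf(2) by blast
      have "max_displacement U z \<le> L + 1"
        using z max_displacement_attained[OF U(1) \<open>U \<noteq> {}\<close>, of z] by metis
      moreover have "(\<Sum>u\<in>U. dist z (\<phi> u z)) \<le> card U * (L + 1)"
        using z by (intro sum_bounded_above) auto
      then have "(\<Sum>u\<in>U. dist z (\<phi> u z)) / card U \<le> L + 1"
        using U \<open>U \<noteq> {}\<close> by (simp add: divide_le_eq card_gt_0_iff mult.commute)
      ultimately have "energy U z \<le> 2 * L + 2" by (simp add: energy_def)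
      moreover have "max_displacement U x \<le> energy U x" unfolding energy_def by (simp add: sum_nonneg)
      ultimately show ?thesis
        using x[of z] max_displacement_ge[OF U(1) that, of x] by (simp add: M_def)
    qed
    have finish: "real (card U) \<le> C * L * card B"
      if A: "card U \<le> 64 * card A" "real (card A) \<le> (M + 1) * N' * card B" "0 \<le> N'" "N' \<le> Nmax"
      for N' and A B :: "'g set"
    proof -
      have "(M + 1) * N' \<le> (6 * L) * Nmax"
        using that L C(1) by (intro mult_mono) (auto simp: M_def)
      then have "(M + 1) * N' * card B \<le> (6 * L) * Nmax * card B" by (intro mult_right_mono) auto
      then have "real (card U) \<le> (384 * Nmax) * L * card B"
        using A(1,2) by (simp add: mult.assoc mult.left_commute)
      also have "\<dots> \<le> C * L * card B"
        using C L by (intro mult_right_mono) auto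
      finally show ?thesis .
    qed
    define V where "V = {u \<in> U. dist x (\<phi> u x) \<le> D}"
    show ?thesis
    proof (cases "8 * card V \<le> card U")
      case True
      obtain v A where vA: "v \<in> U" "A \<subseteq> U" "card U \<le> 64 * card A" "D \<le> dist x (\<phi> v x)"
        "\<And>u. u \<in> A \<Longrightarrow> D < dist x (\<phi> u x)"
        "\<And>u. u \<in> A \<Longrightarrow> gp x (\<phi> (inv u) x) (\<phi> v x) \<le> 19 * \<delta>"
        "\<And>u. u \<in> A \<Longrightarrow> gp x (\<phi> u x) (\<phi> (inv v) x) \<le> 19 * \<delta>"
      proof (rule transverse_family[OF len U \<open>U \<noteq> {}\<close> x, of D])
        show "64 * \<delta> \<le> D" using \<open>\<kappa> r \<ge> 0\<close> delta_ge_1 by (simp add: D_def)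
        show "D + 48 * \<delta> \<le> max_displacement U x"
          using C(2) L M_ge delta_ge_1 \<open>D \<ge> 0\<close> \<open>\<kappa> r1 \<ge> 0\<close> \<open>\<kappa> r2 \<ge> 0\<close> by (simp add: K2_def)
      qed (use True in \<open>auto simp: V_def\<close>)
      have v: "v \<in> carrier G" and A: "u \<in> A \<Longrightarrow> u \<in> carrier G" for u using vA U by auto
      have D_ge: "100 * \<delta> \<le> D" using \<open>\<kappa> r \<ge> 0\<close> by (simp add: D_def)
      obtain B where B: "B \<subseteq> A" "real (card A) \<le> (M + 1) * N r * card B"
        "\<And>k. card (set_power G (B <#> {v}) k) = card B ^ k"
      proof (rule pair_word_growth[of A v K M x r "N r"])
        show "finite A" "A \<subseteq> carrier G" using vA U finite_subset by auto
        show "gp x (\<phi> (inv u) x) (\<phi> v x) \<le> K" if "u \<in> A" for u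
          using vA(6)[OF that] delta_ge_1 by (simp add: K_def)
        show "gp x (\<phi> (inv (u \<otimes> v)) x) (\<phi> (u' \<otimes> v) x) \<le> K" if "u \<in> A" "u' \<in> A" for u u'
        proof -
          \<comment> \<open>The line to the image of \<open>x\<close> under
            \<open>u' \<otimes> v\<close> starts along that to \<open>\<phi> u' x\<close>, so it
            inherits the small product with \<open>\<phi> (inv v) x\<close>.\<close>
          have "gp x (\<phi> u' x) (\<phi> (u' \<otimes> v) x) > 21 * \<delta>"
            using gp_translate[of u' x "\<phi> v x"] A[OF that(2)] v vA(5,6)[OF that(2)] D_ge delta_ge_1
            by (simp add: action_mult)
          then have "gp x (\<phi> (inv v) x) (\<phi> (u' \<otimes> v) x) \<le> 20 * \<delta>"
            using hyperbolic[of x "\<phi> (inv v) x" "\<phi> (u' \<otimes> v) x" "\<phi> u' x"] vA(7)[OF that(2)] delta_ge_1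
            by (simp add: gp_commute min_def split: if_splits)
          from corner_pair[OF A[OF that(1)] v vA(6)[OF that(1)] this]
          show ?thesis using vA(4) D_ge delta_ge_1 by (simp add: K_def)
        qed
        show "4 * K + 2 * \<delta> < dist x (\<phi> v x)"
          using vA(4) D_ge delta_ge_1 by (simp add: K_def)
        have "\<kappa> r \<le> dist x (\<phi> v x)" using vA(4) delta_ge_1 by (simp add: D_def)
        then show "finite {g \<in> carrier G. dist x (\<phi> g x) \<le> r \<and> dist (\<phi> v x) (\<phi> g (\<phi> v x)) \<le> r}"
          "real (card {g \<in> carrier G. dist x (\<phi> g x) \<le> r \<and> dist (\<phi> v x) (\<phi> g (\<phi> v x)) \<le> r}) \<le> N r"
          using few[OF \<open>r \<ge> 0\<close>] by auto
      qed (use v M_le vA(2) L C(1) delta_ge_1 in \<open>auto simp: M_def K_def r_def\<close>)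
      have "real (card U) \<le> C * L * card B"
        using finish[OF vA(3) B(2)] nonneg[OF \<open>r \<ge> 0\<close>] by (simp add: Nmax_def)
      then show ?thesis using vA(1,2) B by blast
    next
      case False
      obtain v where v: "v \<in> U" "dist x (\<phi> v x) = max_displacement U x"
        using max_displacement_attained[OF U(1) \<open>U \<noteq> {}\<close>] by blast
      have far: "dist x (\<phi> v x) > 4 * K2 + 50 * \<delta> + \<kappa> r2" using v M_ge L C(2) by linarith
      have K2: "D \<le> K2" "\<kappa> r1 \<le> K2" "D + \<kappa> r1 + \<delta> = K2"
        using \<open>\<kappa> r1 \<ge> 0\<close> \<open>D \<ge> 0\<close> delta_ge_1 by (simp_all add: K2_def)
      have v_carr: "v \<in> carrier G" using v U by auto
      define S where "S = {u \<in> V. gp x (\<phi> (inv v) x) (\<phi> (u \<otimes> v) x) > \<kappa> r1}"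
      define A where "A = V - S"
      have S: "real (card S) \<le> N r1"
        unfolding S_def
      proof (rule few_backtracking[OF len _ v_carr, of V x D "\<kappa> r1" r1])
        show "\<kappa> r1 \<le> dist x (\<phi> v x)"
          using far K2 \<open>K2 \<ge> 0\<close> \<open>\<kappa> r2 \<ge> 0\<close> delta_ge_1 by linarith
      qed (use U few[OF \<open>r1 \<ge> 0\<close>] \<open>D \<ge> 0\<close> \<open>\<kappa> r1 \<ge> 0\<close> in \<open>auto simp: V_def r1_def\<close>)
      have "finite V" using U by (simp add: V_def)
      then have "card V = card A + card S"
        unfolding A_def S_def by (simp add: card_Diff_subset card_mono)
      moreover have "16 * card S \<le> card U" using S C(3) large by linarith
      ultimately have A_large: "card U \<le> 64 * card A" using False by linarith
      have A: "A \<subseteq> U" "\<And>u. u \<in> A \<Longrightarrow> u \<in> carrier G" "\<And>u. u \<in> A \<Longrightarrow> dist x (\<phi> u x) \<le> D"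
        "\<And>u. u \<in> A \<Longrightarrow> gp x (\<phi> (inv v) x) (\<phi> (u \<otimes> v) x) \<le> \<kappa> r1"
        using U by (auto simp: A_def S_def V_def)
      have inner: "gp x (\<phi> (inv u) x) (\<phi> v x) \<le> D" if "u \<in> A" for u
        using gp_le_dist[of x "\<phi> (inv u) x" "\<phi> v x"] A(2,3)[OF that]
        by (simp add: dist_action_inv dist_commute)
      obtain B where B: "B \<subseteq> A" "real (card A) \<le> (M + 1) * N r2 * card B"
        "\<And>k. card (set_power G (B <#> {v}) k) = card B ^ k"
      proof (rule pair_word_growth[of A v K2 M x r2 "N r2"])
        show "finite A" "A \<subseteq> carrier G" using A U finite_subset by auto
        show "gp x (\<phi> (inv u) x) (\<phi> v x) \<le> K2" if "u \<in> A" for u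
          using inner[OF that] K2 by linarith
        show "gp x (\<phi> (inv (u \<otimes> v)) x) (\<phi> (u' \<otimes> v) x) \<le> K2" if "u \<in> A" "u' \<in> A" for u u'
        proof -
          have "D + \<kappa> r1 + \<delta> < dist x (\<phi> v x)"
            using far K2 \<open>K2 \<ge> 0\<close> \<open>\<kappa> r2 \<ge> 0\<close> delta_ge_1 by linarith
          from corner_pair[OF A(2)[OF that(1)] v_carr inner[OF that(1)] A(4)[OF that(2)] this]
          show ?thesis using K2 \<open>D \<ge> 0\<close> by linarith
        qed
        show "4 * K2 + 2 * \<delta> < dist x (\<phi> v x)" using far \<open>\<kappa> r2 \<ge> 0\<close> delta_ge_1 by linarith
        have "\<kappa> r2 \<le> dist x (\<phi> v x)" using far \<open>K2 \<ge> 0\<close> delta_ge_1 by linarith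
        then show "finite {g \<in> carrier G. dist x (\<phi> g x) \<le> r2 \<and> dist (\<phi> v x) (\<phi> g (\<phi> v x)) \<le> r2}"
          "real (card {g \<in> carrier G. dist x (\<phi> g x) \<le> r2 \<and> dist (\<phi> v x) (\<phi> g (\<phi> v x)) \<le> r2}) \<le> N r2"
          using few[OF \<open>r2 \<ge> 0\<close>] by auto
      qed (use v_carr M_le A(1) L C(1) \<open>K2 \<ge> 0\<close> in \<open>auto simp: M_def r2_def\<close>)
      have "real (card U) \<le> C * L * card B"
        using finish[OF A_large B(2)] nonneg[OF \<open>r2 \<ge> 0\<close>] by (simp add: Nmax_def)
      then show ?thesis using v(1) A(1) B by blast
    qed
  qed
  then show ?thesis using C(1) by (intro exI[of _ C]) simp
qed

end

theorem corollary1p8: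
  fixes G :: "('g, 'm) monoid_scheme" and \<phi> :: "'g \<Rightarrow> 'a \<Rightarrow> 'a::metric_space"
  assumes "group G"
    and "length_space TYPE('a)"
    and "gromov_hyperbolic TYPE('a)"
    and "acylindrical_action G \<phi>"
  shows "\<exists>C::real. C > 0 \<and>
    (\<forall>U. finite U \<longrightarrow> U \<subseteq> carrier G \<longrightarrow> linf_energy \<phi> U > ennreal C \<longrightarrow>
      (\<forall>r::nat. real (card (set_power G U r)) \<ge>
         (1 / (C * enn2real (linf_energy \<phi> U)) * real (card U)) ^ ((r + 1) div 2)))"
proof -
  obtain \<delta>0 where \<delta>0: "\<And>w x y z :: 'a.
      gromov_product w x z \<ge> min (gromov_product w x y) (gromov_product w y z) - \<delta>0"
    using assms(3) unfolding gromov_hyperbolic_def by blast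
  interpret group G by fact
  interpret hyperbolic_action G \<phi> "max \<delta>0 1"
  proof
    show "gromov_product w x z \<ge> min (gromov_product w x y) (gromov_product w y z) - max \<delta>0 1"
      for w x y z :: 'a using \<delta>0[of w x y z] by linarith
  qed (use assms(4) in \<open>simp_all add: acylindrical_action_def\<close>)
  obtain N \<kappa> :: "real \<Rightarrow> real" where nonneg: "\<forall>r\<ge>0. N r \<ge> 0 \<and> \<kappa> r \<ge> 0"
    and few: "\<forall>r\<ge>0. \<forall>x y. dist x y \<ge> \<kappa> r \<longrightarrow>
      (let S = {g \<in> carrier G. dist x (\<phi> g x) \<le> r \<and> dist y (\<phi> g y) \<le> r}
       in finite S \<and> real (card S) \<le> N r)"
    using assms(4) unfolding acylindrical_action_def by blast
  have few': "finite {g \<in> carrier G. dist y (\<phi> g y) \<le> r \<and> dist z (\<phi> g z) \<le> r} \<and>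
      real (card {g \<in> carrier G. dist y (\<phi> g y) \<le> r \<and> dist z (\<phi> g z) \<le> r}) \<le> N r"
    if "r \<ge> 0" "\<kappa> r \<le> dist y z" for r y z
    using few that unfolding Let_def by blast
  obtain C where "C \<ge> 1" and C: "\<forall>U L. finite U \<longrightarrow> U \<subseteq> carrier G \<longrightarrow>
      linf_energy \<phi> U = ennreal L \<longrightarrow> C < L \<longrightarrow> C < card U \<longrightarrow>
      (\<exists>v\<in>U. \<exists>B\<subseteq>U. real (card U) \<le> C * L * card B \<and>
        (\<forall>k. card (set_power G (B <#>\<^bsub>G\<^esub> {v}) k) = card B ^ k))"
    using freely_growing_pairs[OF assms(2) nonneg[rule_format] few'] by force
  have "(1 / (C * enn2real (linf_energy \<phi> U)) * real (card U)) ^ ((r + 1) div 2)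
      \<le> real (card (set_power G U r))"
    if U: "finite U" "U \<subseteq> carrier G" and energetic: "linf_energy \<phi> U > ennreal C" for U r
  proof -
    define L where "L = enn2real (linf_energy \<phi> U)"
    have "U \<noteq> {}" using energetic by (auto simp: linf_energy_def)
    have L: "linf_energy \<phi> U = ennreal L"
      unfolding L_def by (rule linf_energy_finite(1)[OF U(1) \<open>U \<noteq> {}\<close>])
    then have "C < L" using energetic \<open>C \<ge> 1\<close> by (simp add: ennreal_less_iff)
    then have CL: "0 < C * L" "C \<le> C * L" using \<open>C \<ge> 1\<close> by auto
    show ?thesis
    proof (cases "C < card U")
      case True
      then obtain v B where vB: "v \<in> U" "B \<subseteq> U" "real (card U) \<le> C * L * card B"
        "\<And>k. card (set_power G (B <#>\<^bsub>G\<^esub> {v}) k) = card B ^ k"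
        using C[rule_format, OF U L \<open>C < L\<close>] by blast
      have "1 / (C * L) * real (card U) \<le> card B"
        using vB(3) CL(1) by (simp add: divide_le_eq mult.commute)
      then have "(1 / (C * L) * real (card U)) ^ ((r + 1) div 2) \<le> real (card B) ^ ((r + 1) div 2)"
        using CL(1) by (intro power_mono) auto
      also have "\<dots> = real (card (set_power G (B <#>\<^bsub>G\<^esub> {v}) ((r + 1) div 2)))"
        by (simp add: vB(4))
      also have "\<dots> \<le> real (card (set_power G U r))"
        using card_set_power_ge_pairs[OF U vB(2,1)] by simp
      finally show ?thesis by (simp add: L_def)
    next
      case False
      \<comment> \<open>For a set of at most \<open>C\<close> elements the base is at most 1, and it
        suffices that powers of a nonempty set are nonempty.\<close>
      then have "1 / (C * L) * real (card U) \<le> 1" using CL by (simp add: divide_le_eq)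
      then have "(1 / (C * L) * real (card U)) ^ ((r + 1) div 2) \<le> 1"
        using CL(1) by (intro power_le_one) auto
      also have "1 \<le> real (card (set_power G U r))"
      proof -
        have "set_power G U r \<noteq> {}"
          using \<open>U \<noteq> {}\<close> by (induction r) (auto simp: set_mult_def)
        then have "card (set_power G U r) \<noteq> 0" using finite_set_power[OF U(1)] by simp
        then show ?thesis by linarith
      qed
      finally show ?thesis by (simp add: L_def)
    qed
  qed
  then show ?thesis using \<open>C \<ge> 1\<close> by (intro exI[of _ C]) auto
qed

end
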